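(* Let $C$ and $D$ be sets of nonnegative integers such that $C \cup D = \mathbb{N}$, $C \cap D = \emptyset$ and $0 \in C$. Then $R_C(n) = R_D(n)$ for every positive integer $n$ if and only if $C = A$ and $D = B$.
   Context: $\mathbb{N} = \{0,1,2,\dots\}$ denotes the set of nonnegative integers. For a set $S$ of nonnegative integers, $R_S(n)$ denotes the number of solutions of $s + s' = n$ with $s, s' \in S$ and $s < s'$. $A$ is the set of those nonnegative integers whose binary representation contains an even number of digits $1$ (so $0 \in A$), and $B = \mathbb{N} \setminus A$. *)

theory Defs
  imports Main
begin

definition rep_count :: "nat set \<Rightarrow> nat \<Rightarrow> nat" where
  "rep_count S n = card {(s, s'). s \<in> S \<and> s' \<in> S \<and> s < s' \<and> s + s' = n}"

text \<open>
  \<^term>\<open>bit n k\<close> says that the binary digit of \<^term>\<open>n\<close> at weight \<^term>\<open>2 ^ k\<close> is 1.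
  Both this count and \<^const>\<open>rep_count\<close> are cardinalities of finite sets, as shown below.
\<close>

definition binary_ones :: "nat \<Rightarrow> nat" where
  "binary_ones n = card {k. bit n k}"

lemma finite_rep_count_set:
  "finite {(s, s'). s \<in> S \<and> s' \<in> S \<and> s < s' \<and> s + s' = (n::nat)}"
  by (rule finite_subset[of _ "{..n} \<times> {..n}"]) auto

lemma finite_bit_set_nat: "finite {k. bit (n::nat) k}"
proof (rule finite_subset)
  show "{k. bit n k} \<subseteq> {..<n}"
  proof
    fix k assume "k \<in> {k. bit n k}"
    then have "odd (n div 2 ^ k)" by (simp add: bit_iff_odd)
    then have "2 ^ k \<le> n" by (metis div_less even_zero not_le)
    then show "k \<in> {..<n}" using less_le_trans[OF less_exp[of k]] by simp
  qed
qed simp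

definition A :: "nat set" where
  "A = {n. even (binary_ones n)}"

definition B :: "nat set" where
  "B = UNIV - A"

end

theory Submission
  imports Defs
begin

text \<open>
  With the sign \<open>\<epsilon>\<close> of a set \<open>C\<close> (1 on \<open>C\<close>, -1 off \<open>C\<close>), a pair \<open>s < s'\<close> with
  \<open>s + s' = n\<close> contributes \<open>(\<epsilon> s + \<epsilon> s') / 2\<close> to \<open>R_C(n) - R_D(n)\<close>. So
  \<open>2 (R_C(n) - R_D(n))\<close> is the sum of \<open>\<epsilon> i\<close> over all \<open>i \<le> n\<close> except \<open>i = n / 2\<close>.
  Vanishing of all these quantities prescribes the partial sums of \<open>\<epsilon>\<close>; taking differences,
  it is equivalent to the recursion \<open>\<epsilon> (2 m) = \<epsilon> m\<close>, \<open>\<epsilon> (2 m + 1) = - \<epsilon> m\<close>, which together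
  with \<open>\<epsilon> 0 = 1\<close> characterises the sign of \<open>A\<close>.
\<close>

definition set_sign :: "'a set \<Rightarrow> 'a \<Rightarrow> int" where
  "set_sign S x = (if x \<in> S then 1 else -1)"

lemma set_sign_inject: "set_sign S = set_sign T \<longleftrightarrow> S = T"
  by (auto simp: set_sign_def fun_eq_iff set_eq_iff split: if_splits)

text \<open>A pair is determined by its smaller entry \<open>s\<close>, and \<open>s < n - s\<close>
  amounts to \<open>2 * s < n\<close>. The summation range thus no longer depends on
  \<open>S\<close>, so the counts for \<open>S\<close> and \<open>- S\<close> can be subtracted
  termwise.\<close>

lemma rep_count_eq_sum:
  "int (rep_count S n) = (\<Sum>s | 2 * s < n. of_bool (s \<in> S \<and> n - s \<in> S))"
proof -
  have fin: "finite {s. 2 * s < n}"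
    by (rule finite_subset[of _ "{..n}"]) auto
  have "bij_betw fst {(s, s'). s \<in> S \<and> s' \<in> S \<and> s < s' \<and> s + s' = n}
      {s \<in> {s. 2 * s < n}. s \<in> S \<and> n - s \<in> S}"
    by (rule bij_betw_byWitness[where f' = "\<lambda>s. (s, n - s)"]) auto
  then have "rep_count S n = card {s \<in> {s. 2 * s < n}. s \<in> S \<and> n - s \<in> S}"
    unfolding rep_count_def by (rule bij_betw_same_card)
  also have "int \<dots> = (\<Sum>s | 2 * s < n. of_bool (s \<in> S \<and> n - s \<in> S))"
    using fin by (simp add: sum.If_cases of_bool_def Int_def)
  finally show ?thesis .
qed

lemma rep_count_0: "rep_count S 0 = 0"
  by (auto simp: rep_count_def card_eq_0_iff)

lemma rep_count_diff_compl:
  "2 * (int (rep_count S n) - int (rep_count (- S) n)) =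
    (\<Sum>i\<le>n. set_sign S i) - (if even n then set_sign S (n div 2) else 0)"
proof -
  let ?L = "{s. 2 * s < n}" and ?M = "{s. 2 * s = n}" and ?U = "{s. s \<le> n \<and> n < 2 * s}"
  have fin: "finite ?L" "finite ?M" "finite ?U"
    by (rule finite_subset[of _ "{..n}"]; auto)+
  have "2 * (int (rep_count S n) - int (rep_count (- S) n)) =
      (\<Sum>s\<in>?L. set_sign S s + set_sign S (n - s))"
    unfolding rep_count_eq_sum sum_subtractf[symmetric] sum_distrib_left
    by (rule sum.cong) (auto simp: set_sign_def)
  also have "\<dots> = sum (set_sign S) ?L + (\<Sum>s\<in>?L. set_sign S (n - s))"
    by (rule sum.distrib)
  \<comment> \<open>Reflection in \<open>n / 2\<close> exchanges the lower and upper halves of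
    \<open>{..n}\<close>; only a midpoint stays uncovered.\<close>
  also have "(\<Sum>s\<in>?L. set_sign S (n - s)) = sum (set_sign S) ?U"
    by (rule sum.reindex_bij_witness[of _ "\<lambda>s. n - s" "\<lambda>s. n - s"]) auto
  finally have diff: "2 * (int (rep_count S n) - int (rep_count (- S) n)) =
      sum (set_sign S) ?L + sum (set_sign S) ?U" .
  have "{..n} = ?L \<union> ?M \<union> ?U"
    by auto
  then have "(\<Sum>i\<le>n. set_sign S i) = sum (set_sign S) (?L \<union> ?M \<union> ?U)"
    by simp
  also have "\<dots> = sum (set_sign S) (?L \<union> ?M) + sum (set_sign S) ?U"
    using fin by (intro sum.union_disjoint) auto
  also have "sum (set_sign S) (?L \<union> ?M) = sum (set_sign S) ?L + sum (set_sign S) ?M"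
    using fin by (intro sum.union_disjoint) auto
  also have "?M = (if even n then {n div 2} else {})"
    by auto
  finally show ?thesis
    using diff by auto
qed

lemma partial_sums_iff_double_recursion:
  fixes f :: "nat \<Rightarrow> 'a::ab_group_add"
  shows "(\<forall>n. (\<Sum>i\<le>n. f i) = (if even n then f (n div 2) else 0)) \<longleftrightarrow>
    (\<forall>m. f (2 * m) = f m \<and> f (2 * m + 1) = - f m)"
    (is "(\<forall>n. ?P n) \<longleftrightarrow> ?R")
proof
  assume sums: "\<forall>n. ?P n"
  have "f (2 * m) = f m" for m
  proof (cases m)
    case (Suc k)
    \<comment> \<open>The sum up to the odd index \<open>2 * m - 1\<close> is 0 and the sum up to
      \<open>2 * m\<close> is \<open>f m\<close>; their difference is the term
      \<open>f (2 * m)\<close>.\<close>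
    show ?thesis
      using sums[rule_format, of "Suc (2 * k)"] sums[rule_format, of "2 * m"] Suc by simp
  qed simp
  moreover have "f (2 * m + 1) = - f m" for m
    using sums[rule_format, of "Suc (2 * m)"] sums[rule_format, of "2 * m"]
    by (simp add: eq_neg_iff_add_eq_0 add.commute)
  ultimately show ?R
    by blast
next
  assume rec: ?R
  \<comment> \<open>The terms at \<open>2 * m\<close> and \<open>2 * m + 1\<close> cancel, so the
    sum returns to 0 at each odd index and the next even index leaves a single term.\<close>
  have even_odd: "?P (2 * m) \<and> ?P (Suc (2 * m))" for m
  proof (induction m)
    case 0
    show ?case
      using rec[rule_format, of 0] by simp
  next
    case (Suc m)
    then show ?case
      using rec[rule_format, of m] rec[rule_format, of "Suc m"] by simp
  qed
  show "\<forall>n. ?P n"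
  proof
    fix n
    show "?P n"
      using even_odd[of "n div 2"] by (cases "even n") (auto elim: oddE)
  qed
qed

text \<open>Repeated halving leads every argument down to 0, so only the value at 0 is free.\<close>

lemma double_recursion_unique:
  assumes "\<And>m. f (2 * m) = f m \<and> f (2 * m + 1) = - f m"
    and "\<And>m. g (2 * m) = g m \<and> g (2 * m + 1) = - g m"
    and "f 0 = g (0::nat)"
  shows "f = g"
proof
  fix n
  show "f n = g n"
  proof (induction n rule: less_induct)
    case (less n)
    show ?case
    proof (cases "n = 0")
      case False
      then have "f (n div 2) = g (n div 2)"
        using less by simp
      then show ?thesis
        using assms(1,2)[of "n div 2"]
        by (cases "even n") (simp_all add: odd_two_times_div_two_succ)
    qed (use assms(3) in simp)
  qed
qed

lemma binary_ones_double: "binary_ones (2 * m) = binary_ones m"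
proof -
  have "bit (2 * m) k \<longleftrightarrow> (\<exists>j. k = Suc j \<and> bit m j)" for k
    by (cases k) (simp_all add: bit_0 bit_Suc)
  then have "{k. bit (2 * m) k} = Suc ` {k. bit m k}"
    by auto
  then show ?thesis
    by (simp add: binary_ones_def card_image)
qed

lemma binary_ones_double_Suc: "binary_ones (2 * m + 1) = Suc (binary_ones m)"
proof -
  have "bit (2 * m + 1) k \<longleftrightarrow> k = 0 \<or> (\<exists>j. k = Suc j \<and> bit m j)" for k
    by (cases k) (simp_all add: bit_0 bit_Suc)
  then have "{k. bit (2 * m + 1) k} = insert 0 (Suc ` {k. bit m k})"
    by auto
  then show ?thesis
    by (simp add: binary_ones_def card_image finite_bit_set_nat)
qed

text \<open>Appending a binary digit 0 keeps the parity of the number of ones; appending a 1 flips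
  it.\<close>

lemma set_sign_A_recursion:
  "set_sign A (2 * m) = set_sign A m \<and> set_sign A (2 * m + 1) = - set_sign A m"
  unfolding set_sign_def A_def mem_Collect_eq binary_ones_double binary_ones_double_Suc by simp

lemma zero_in_A: "0 \<in> A"
  by (simp add: A_def binary_ones_def bot_fun_def)

theorem theorem2:
  fixes C D :: "nat set"
  assumes "C \<union> D = UNIV" and "C \<inter> D = {}" and "0 \<in> C"
  shows "(\<forall>n>0. rep_count C n = rep_count D n) \<longleftrightarrow> C = A \<and> D = B"
proof -
  have D: "D = - C"
    using assms(1,2) by auto
  \<comment> \<open>Both counts vanish at 0, which lets \<open>n\<close> range over all naturals, as
    the partial sum criterion requires.\<close>
  have "(\<forall>n>0. rep_count C n = rep_count D n) \<longleftrightarrow> (\<forall>n. rep_count C n = rep_count D n)"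
    using rep_count_0 by (metis gr_zeroI)
  also have "\<dots> \<longleftrightarrow>
      (\<forall>n. (\<Sum>i\<le>n. set_sign C i) = (if even n then set_sign C (n div 2) else 0))"
  proof (intro all_cong1)
    fix n
    show "rep_count C n = rep_count D n \<longleftrightarrow>
        (\<Sum>i\<le>n. set_sign C i) = (if even n then set_sign C (n div 2) else 0)"
      using rep_count_diff_compl[of C n] unfolding D by (auto simp del: if_split)
  qed
  also have "\<dots> \<longleftrightarrow>
      (\<forall>m. set_sign C (2 * m) = set_sign C m \<and> set_sign C (2 * m + 1) = - set_sign C m)"
    by (rule partial_sums_iff_double_recursion)
  also have "\<dots> \<longleftrightarrow> set_sign C = set_sign A"
  proof
    assume "\<forall>m. set_sign C (2 * m) = set_sign C m \<and> set_sign C (2 * m + 1) = - set_sign C m"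
    moreover have "set_sign C 0 = set_sign A 0"
      using assms(3) zero_in_A by (simp add: set_sign_def)
    ultimately show "set_sign C = set_sign A"
      using set_sign_A_recursion by (intro double_recursion_unique) blast+
  qed (use set_sign_A_recursion in simp)
  also have "\<dots> \<longleftrightarrow> C = A \<and> D = B"
    by (auto simp: set_sign_inject D B_def)
  finally show ?thesis .
qed

end
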